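(* Let $\hat u^*=(\hat u_0^*,\dots,\hat u_{N-1}^* )$ be a sequence of control inputs that solves the optimization problem $$\begin{aligned}\min_{\hat u}\ & \sum_{k=0}^{N-1}\Delta\tilde V_k(x_k,\hat u_k)\\ \text{subject to } & x_{k+1}=\hat f_k(x_k,\hat u_k)\quad \forall k\in\mathbb Z_N,\\ & (x_k,\kappa_k(x_k)+\hat u_k)\in\mathcal C_k\quad \forall k\in\mathbb Z_N,\\ & x_N\in\mathcal X_N,\end{aligned}$$ with $x_0$ given. Define $\hat x_0^*=x_0$ and $\hat x_{k+1}^*=\hat f_k(\hat x_k^*,\hat u_k^* )$ for $k\in\mathbb Z_N$. Then the sequence of control inputs $u^*=(u_0^*,\dots,u_{N-1}^* )$ satisfying $$u_k^*=\kappa_k(\hat x_k^* )+\hat u_k^*\quad\text{for all }k\in\mathbb Z_N$$ solves the optimization problem $$\begin{aligned}\min_{u}\ & V_f(x_N)+\sum_{k=0}^{N-1}L_k(x_k,u_k)\\ \text{subject to } & x_{k+1}=f_k(x_k,u_k)\quad \forall k\in\mathbb Z_N,\\ & (x_k,u_k)\in\mathcal C_k\quad \forall k\in\mathbb Z_N,\\ & x_N\in\mathcal X_N,\end{aligned}$$ with the same given $x_0$.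
   Context: $N$ is a positive integer and $\mathbb Z_N=\{0,1,\dots,N-1\}$ is the set of the first $N$ non-negative integers. The initial state $x_0\in\mathbb R^n$ is given. For each $k\in\mathbb Z_N$, $f_k:\mathbb R^n\times\mathbb R^m\to\mathbb R^n$ is continuous with $f_k(0,0)=0$, and $\mathcal C_k\subset\mathbb R^n\times\mathbb R^m$ is closed; $\mathcal X_N\subset\mathbb R^n$ is the terminal constraint set. The cost functions $V_f:\mathbb R^n\to\mathbb R$ and $L_k:\mathbb R^n\times\mathbb R^m\to\mathbb R$ are continuous and locally bounded and satisfy $L_k(0,0)=V_f(0)=0$, $L_k(x,u)\ge\alpha(\|u\|)$ and $V_f(x)\ge 0$ for all $x\in\mathbb R^n$, $u\in\mathbb R^m$, $k\in\mathbb Z_N$, where $\alpha$ is a $\mathcal K_\infty$-function (i.e., $\alpha:[0,\infty)\to[0,\infty)$ is continuous, strictly increasing, unbounded, with $\alpha(0)=0$). A sequence of control inputs "solves" an optimization problem if it, together with the state trajectory it generates from $x_0$, satisfies the constraints and attains the minimum of the cost over all such sequences. The unconstrained value functions $\tilde V_k:\mathbb R^n\to\mathbb R$ are defined by $\tilde V_N=V_f$ and, for $k\in\mathbb Z_N$, $$\tilde V_k(x)=\min_{u\in\mathbb R^m}\ \tilde V_{k+1}(f_k(x,u))+L_k(x,u).$$ For each $k\in\mathbb Z_N$, $\kappa_k:\mathbb R^n\to\mathbb R^m$ is a feedback law selecting, for every $x$, an (arbitrarily chosen) minimizer in this problem, so that $\tilde V_k(x)=\tilde V_{k+1}(f_k(x,\kappa_k(x)))+L_k(x,\kappa_k(x))$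 for all $x\in\mathbb R^n$. For $k\in\mathbb Z_N$ define $$\hat f_k(x,\hat u)=f_k(x,\kappa_k(x)+\hat u),\qquad \hat L_k(x,\hat u)=L_k(x,\kappa_k(x)+\hat u),$$ $$\Delta\tilde V_k(x,\hat u)=\tilde V_{k+1}(\hat f_k(x,\hat u))+\hat L_k(x,\hat u)-\tilde V_k(x).$$ *)

theory Defs
  imports "HOL-Analysis.Analysis"
begin

definition class_K_inf :: "(real \<Rightarrow> real) \<Rightarrow> bool" where
  "class_K_inf \<alpha> \<longleftrightarrow>
     \<alpha> \<in> {0..} \<rightarrow> {0..} \<and> continuous_on {0..} \<alpha> \<and> strict_mono_on {0..} \<alpha> \<and>
     \<not> bounded (\<alpha> ` {0..}) \<and> \<alpha> 0 = 0"

definition locally_bounded :: "('a::topological_space \<Rightarrow> 'b::metric_space) \<Rightarrow> bool" where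
  "locally_bounded g \<longleftrightarrow> (\<forall>x. \<exists>U. open U \<and> x \<in> U \<and> bounded (g ` U))"

text \<open>A control sequence of horizon \<open>N\<close> is a function on \<open>nat\<close> of which only the values at
  \<open>0, \<dots>, N - 1\<close> matter: neither the constraints nor the cost below look at any others.\<close>

primrec trajectory :: "(nat \<Rightarrow> 'x \<times> 'u \<Rightarrow> 'x) \<Rightarrow> 'x \<Rightarrow> (nat \<Rightarrow> 'u) \<Rightarrow> nat \<Rightarrow> 'x" where
  "trajectory f x\<^sub>0 u 0 = x\<^sub>0"
| "trajectory f x\<^sub>0 u (Suc k) = f k (trajectory f x\<^sub>0 u k, u k)"

definition feasible ::
  "nat \<Rightarrow> (nat \<Rightarrow> 'x \<times> 'u \<Rightarrow> 'x) \<Rightarrow> (nat \<Rightarrow> ('x \<times> 'u) set) \<Rightarrow> 'x set \<Rightarrow> 'x \<Rightarrow> (nat \<Rightarrow> 'u) \<Rightarrow> bool"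
where
  "feasible N f C X x\<^sub>0 u \<longleftrightarrow>
     (\<forall>k<N. (trajectory f x\<^sub>0 u k, u k) \<in> C k) \<and> trajectory f x\<^sub>0 u N \<in> X"

definition total_cost ::
  "nat \<Rightarrow> (nat \<Rightarrow> 'x \<times> 'u \<Rightarrow> 'x) \<Rightarrow> ('x \<Rightarrow> real) \<Rightarrow> (nat \<Rightarrow> 'x \<times> 'u \<Rightarrow> real) \<Rightarrow> 'x \<Rightarrow> (nat \<Rightarrow> 'u) \<Rightarrow> real"
where
  "total_cost N f V\<^sub>f L x\<^sub>0 u =
     V\<^sub>f (trajectory f x\<^sub>0 u N) + (\<Sum>k<N. L k (trajectory f x\<^sub>0 u k, u k))"

definition solves_ocp ::
  "nat \<Rightarrow> (nat \<Rightarrow> 'x \<times> 'u \<Rightarrow> 'x) \<Rightarrow> (nat \<Rightarrow> ('x \<times> 'u) set) \<Rightarrow> 'x set \<Rightarrow>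
   ('x \<Rightarrow> real) \<Rightarrow> (nat \<Rightarrow> 'x \<times> 'u \<Rightarrow> real) \<Rightarrow> 'x \<Rightarrow> (nat \<Rightarrow> 'u) \<Rightarrow> bool"
where
  "solves_ocp N f C X V\<^sub>f L x\<^sub>0 u \<longleftrightarrow>
     is_arg_min (total_cost N f V\<^sub>f L x\<^sub>0) (feasible N f C X x\<^sub>0) u"

text \<open>Backward recursion in the stage \<open>k\<close>, starting from \<open>V\<^sub>f\<close> at \<open>k = N\<close>; indices \<open>k > N\<close> are
  irrelevant and also get \<open>V\<^sub>f\<close>. The minimum over all controls is the least element of the set of
  attained values, so it is only meaningful where the minimum is attained.\<close>

function value_fun ::
  "nat \<Rightarrow> (nat \<Rightarrow> 'x \<times> 'u \<Rightarrow> 'x) \<Rightarrow> ('x \<Rightarrow> real) \<Rightarrow> (nat \<Rightarrow> 'x \<times> 'u \<Rightarrow> real) \<Rightarrow> nat \<Rightarrow> 'x \<Rightarrow> real"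
where
  "value_fun N f V\<^sub>f L k =
     (if k < N
      then (\<lambda>x. LEAST v. v \<in> range (\<lambda>u. value_fun N f V\<^sub>f L (Suc k) (f k (x, u)) + L k (x, u)))
      else V\<^sub>f)"
  by pat_completeness auto
termination
  by (relation "Wellfounded.measure (\<lambda>(N, f, V\<^sub>f, L, k). N - k)") auto

declare value_fun.simps [simp del]

definition minimizing_feedback ::
  "nat \<Rightarrow> (nat \<Rightarrow> 'x \<times> 'u \<Rightarrow> 'x) \<Rightarrow> ('x \<Rightarrow> real) \<Rightarrow> (nat \<Rightarrow> 'x \<times> 'u \<Rightarrow> real) \<Rightarrow> (nat \<Rightarrow> 'x \<Rightarrow> 'u) \<Rightarrow> bool"
where
  "minimizing_feedback N f V\<^sub>f L \<kappa> \<longleftrightarrow>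
     (\<forall>k<N. \<forall>x. is_arg_min
        (\<lambda>u. value_fun N f V\<^sub>f L (Suc k) (f k (x, u)) + L k (x, u)) (\<lambda>u. True) (\<kappa> k x))"

text \<open>With \<open>g = f\<close> and \<open>g = L\<close> this gives the closed-loop dynamics and stage cost.\<close>

definition shifted :: "(nat \<Rightarrow> 'x \<Rightarrow> 'u::plus) \<Rightarrow> (nat \<Rightarrow> 'x \<times> 'u \<Rightarrow> 'c) \<Rightarrow> nat \<Rightarrow> 'x \<times> 'u \<Rightarrow> 'c" where
  "shifted \<kappa> g k = (\<lambda>(x, v). g k (x, \<kappa> k x + v))"

definition shifted_constraint ::
  "(nat \<Rightarrow> 'x \<Rightarrow> 'u::plus) \<Rightarrow> (nat \<Rightarrow> ('x \<times> 'u) set) \<Rightarrow> nat \<Rightarrow> ('x \<times> 'u) set"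
where
  "shifted_constraint \<kappa> C k = {(x, v). (x, \<kappa> k x + v) \<in> C k}"

definition delta_value ::
  "nat \<Rightarrow> (nat \<Rightarrow> 'x \<times> 'u \<Rightarrow> 'x) \<Rightarrow> ('x \<Rightarrow> real) \<Rightarrow> (nat \<Rightarrow> 'x \<times> 'u \<Rightarrow> real) \<Rightarrow> (nat \<Rightarrow> 'x \<Rightarrow> 'u::plus) \<Rightarrow>
   nat \<Rightarrow> 'x \<times> 'u \<Rightarrow> real"
where
  "delta_value N f V\<^sub>f L \<kappa> k = (\<lambda>(x, v).
     value_fun N f V\<^sub>f L (Suc k) (shifted \<kappa> f k (x, v)) + shifted \<kappa> L k (x, v)
     - value_fun N f V\<^sub>f L k x)"

end

theory Submission
  imports Defs
begin

text \<open>Along any trajectory the stage costs \<open>\<Delta>V\<^sub>k\<close> telescope: each one adds the value function at the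
  next state, subtracts it at the current state, and adds the original stage cost. Since the
  value function at stage \<open>N\<close> is the terminal cost, the shifted cost of a control sequence is the
  original cost of the corresponding sequence minus \<open>V\<^sub>0(x\<^sub>0)\<close>, a constant
  (\<open>total_cost_delta_value\<close>).

  The correspondence \<open>u\<^sub>k = \<kappa>\<^sub>k(x\<^sub>k) + v\<^sub>k\<close>, read along the common state trajectory, preserves
  feasibility (\<open>feasible_shifted_iff\<close>), and every \<open>u\<close> arises from some \<open>v\<close>. Hence the two problems
  have the same feasible trajectories and costs that differ by a constant, so minimizers
  correspond to minimizers.\<close>

text \<open>Since neither input sequence determines the other without the states they generate, the
  correspondence is formulated relative to a common state sequence. This single formulation covers
  passing from \<open>v\<close> to \<open>u\<close> (with the closed-loop trajectory) and from \<open>u\<close> to \<open>v\<close> (with the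
  open-loop one).\<close>

definition corresponding_inputs ::
  "nat \<Rightarrow> (nat \<Rightarrow> 'x \<times> 'u \<Rightarrow> 'x) \<Rightarrow> (nat \<Rightarrow> 'x \<Rightarrow> 'u::plus) \<Rightarrow> 'x \<Rightarrow>
   (nat \<Rightarrow> 'x) \<Rightarrow> (nat \<Rightarrow> 'u) \<Rightarrow> (nat \<Rightarrow> 'u) \<Rightarrow> bool"
where
  "corresponding_inputs N f \<kappa> x\<^sub>0 x u v \<longleftrightarrow>
     x 0 = x\<^sub>0 \<and> (\<forall>k<N. x (Suc k) = f k (x k, u k) \<and> u k = \<kappa> k (x k) + v k)"

lemma trajectory_eqI:
  assumes "x 0 = x\<^sub>0" and "\<And>k. k < N \<Longrightarrow> x (Suc k) = f k (x k, u k)"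
  shows "k \<le> N \<Longrightarrow> trajectory f x\<^sub>0 u k = x k"
  using assms by (induction k) auto

lemma corresponding_trajectories:
  assumes "corresponding_inputs N f \<kappa> x\<^sub>0 x u v" and "k \<le> N"
  shows "trajectory f x\<^sub>0 u k = x k"
    and "trajectory (shifted \<kappa> f) x\<^sub>0 v k = x k"
  using assms trajectory_eqI[of x x\<^sub>0 N f u k] trajectory_eqI[of x x\<^sub>0 N "shifted \<kappa> f" v k]
  by (simp_all add: corresponding_inputs_def shifted_def)

lemma feasible_shifted_iff:
  assumes "corresponding_inputs N f \<kappa> x\<^sub>0 x u v"
  shows "feasible N (shifted \<kappa> f) (shifted_constraint \<kappa> C) X x\<^sub>0 v \<longleftrightarrow> feasible N f C X x\<^sub>0 u"
  using assms
  by (simp add: feasible_def shifted_constraint_def corresponding_trajectories[OF assms]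
      corresponding_inputs_def)

text \<open>The differences of value functions telescope; the boundary term at stage \<open>N\<close> supplies the
  terminal cost that the shifted problem lacks.\<close>

lemma total_cost_delta_value:
  assumes "corresponding_inputs N f \<kappa> x\<^sub>0 x u v"
  shows "total_cost N (shifted \<kappa> f) (\<lambda>x. 0) (delta_value N f V\<^sub>f L \<kappa>) x\<^sub>0 v
       = total_cost N f V\<^sub>f L x\<^sub>0 u - value_fun N f V\<^sub>f L 0 x\<^sub>0"
proof -
  let ?V = "value_fun N f V\<^sub>f L"
  have x: "x 0 = x\<^sub>0" "\<And>k. k < N \<Longrightarrow> f k (x k, \<kappa> k (x k) + v k) = x (Suc k)"
      "\<And>k. k < N \<Longrightarrow> u k = \<kappa> k (x k) + v k"
    using assms by (auto simp: corresponding_inputs_def)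
  have "total_cost N (shifted \<kappa> f) (\<lambda>x. 0) (delta_value N f V\<^sub>f L \<kappa>) x\<^sub>0 v
      = (\<Sum>k<N. (?V (Suc k) (x (Suc k)) - ?V k (x k)) + L k (x k, u k))"
    by (auto simp: total_cost_def corresponding_trajectories[OF assms] delta_value_def
        shifted_def x intro!: sum.cong)
  also have "\<dots> = (?V N (x N) - ?V 0 x\<^sub>0) + (\<Sum>k<N. L k (x k, u k))"
    by (simp add: sum.distrib sum_lessThan_telescope[of "\<lambda>k. ?V k (x k)"] x(1))
  also have "?V N (x N) = V\<^sub>f (x N)"
    by (simp add: value_fun.simps)
  finally show ?thesis
    by (simp add: total_cost_def corresponding_trajectories[OF assms])
qed

text \<open>A competitor \<open>u'\<close> in the original problem is translated, along its own trajectory, into a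
  competitor in the shifted problem, where optimality of \<open>v\<close> applies.\<close>

lemma solves_ocp_of_shifted:
  fixes \<kappa> :: "nat \<Rightarrow> 'x \<Rightarrow> 'u::group_add"
  assumes corr: "corresponding_inputs N f \<kappa> x\<^sub>0 x u v"
    and opt: "solves_ocp N (shifted \<kappa> f) (shifted_constraint \<kappa> C) X
      (\<lambda>x. 0) (delta_value N f V\<^sub>f L \<kappa>) x\<^sub>0 v"
  shows "solves_ocp N f C X V\<^sub>f L x\<^sub>0 u"
  unfolding solves_ocp_def is_arg_min_linorder
proof (intro conjI allI impI)
  show "feasible N f C X x\<^sub>0 u"
    using opt feasible_shifted_iff[OF corr] by (simp add: solves_ocp_def is_arg_min_def)
next
  fix u' assume feas: "feasible N f C X x\<^sub>0 u'"
  define x' where "x' = trajectory f x\<^sub>0 u'"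
  define v' where "v' k = - \<kappa> k (x' k) + u' k" for k
  have corr': "corresponding_inputs N f \<kappa> x\<^sub>0 x' u' v'"
    by (simp add: corresponding_inputs_def x'_def v'_def add.assoc[symmetric])
  have "feasible N (shifted \<kappa> f) (shifted_constraint \<kappa> C) X x\<^sub>0 v'"
    using feas feasible_shifted_iff[OF corr'] by simp
  then have "total_cost N (shifted \<kappa> f) (\<lambda>x. 0) (delta_value N f V\<^sub>f L \<kappa>) x\<^sub>0 v
      \<le> total_cost N (shifted \<kappa> f) (\<lambda>x. 0) (delta_value N f V\<^sub>f L \<kappa>) x\<^sub>0 v'"
    using opt by (simp add: solves_ocp_def is_arg_min_linorder)
  then show "total_cost N f V\<^sub>f L x\<^sub>0 u \<le> total_cost N f V\<^sub>f L x\<^sub>0 u'"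
    by (simp add: total_cost_delta_value[OF corr] total_cost_delta_value[OF corr'])
qed

theorem theorem1:
  fixes N :: nat
    and x\<^sub>0 :: "real ^ 'n"
    and f :: "nat \<Rightarrow> (real ^ 'n) \<times> (real ^ 'm) \<Rightarrow> real ^ 'n"
    and C :: "nat \<Rightarrow> ((real ^ 'n) \<times> (real ^ 'm)) set"
    and X\<^sub>N :: "(real ^ 'n) set"
    and V\<^sub>f :: "real ^ 'n \<Rightarrow> real"
    and L :: "nat \<Rightarrow> (real ^ 'n) \<times> (real ^ 'm) \<Rightarrow> real"
    and \<alpha> :: "real \<Rightarrow> real"
    and \<kappa> :: "nat \<Rightarrow> real ^ 'n \<Rightarrow> real ^ 'm"
    and uhat u :: "nat \<Rightarrow> real ^ 'm"
    and xhat :: "nat \<Rightarrow> real ^ 'n"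
  assumes "N > 0"
    and "\<And>k. k < N \<Longrightarrow> continuous_on UNIV (f k)"
    and "\<And>k. k < N \<Longrightarrow> f k (0, 0) = 0"
    and "\<And>k. k < N \<Longrightarrow> closed (C k)"
    and "continuous_on UNIV V\<^sub>f" and "locally_bounded V\<^sub>f"
    and "\<And>k. k < N \<Longrightarrow> continuous_on UNIV (L k)"
    and "\<And>k. k < N \<Longrightarrow> locally_bounded (L k)"
    and "\<And>k. k < N \<Longrightarrow> L k (0, 0) = 0" and "V\<^sub>f 0 = 0"
    and "class_K_inf \<alpha>"
    and "\<And>k x v. k < N \<Longrightarrow> L k (x, v) \<ge> \<alpha> (norm v)"
    and "\<And>x. V\<^sub>f x \<ge> 0"
    and "minimizing_feedback N f V\<^sub>f L \<kappa>"
    and "solves_ocp N (shifted \<kappa> f) (shifted_constraint \<kappa> C) X\<^sub>N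
           (\<lambda>x. 0) (delta_value N f V\<^sub>f L \<kappa>) x\<^sub>0 uhat"
    and "xhat 0 = x\<^sub>0"
    and "\<And>k. k < N \<Longrightarrow> xhat (Suc k) = shifted \<kappa> f k (xhat k, uhat k)"
    and "\<And>k. k < N \<Longrightarrow> u k = \<kappa> k (xhat k) + uhat k"
  shows "solves_ocp N f C X\<^sub>N V\<^sub>f L x\<^sub>0 u"
proof (rule solves_ocp_of_shifted)
  show "corresponding_inputs N f \<kappa> x\<^sub>0 xhat u uhat"
    unfolding corresponding_inputs_def using assms(16-18) by (simp add: shifted_def)
qed (rule assms(15))

end
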